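(* Let $\Omega\subset\mathbb{R}^3$ be a compact convex domain, let $\beta>0$ be fixed, and let $J_\beta^{\mathrm{TV}}(\varphi):=\int_\Omega\sqrt{\|\nabla\varphi(x)\|_2^2+\beta}\,dx$ for $\varphi\in W^{1,2}(\Omega)$. Let $\mathcal{T}:W^{1,2}(\Omega)\to L^2(\mathcal{Z})$ be linear, compact and injective, let $\varphi^\dagger\in W^{1,2}(\Omega)$, let $\Psi$ be a concave index function, $\tilde\gamma\in(0,1]$, and let $1\le\underline{\tau}\le\overline{\tau}$ be fixed. For noise levels $\delta>0$ let $f^\delta\in L^2(\mathcal{Z})$ satisfy $\|\mathcal{T}\varphi^\dagger-f^\delta\|_{L^2(\mathcal{Z})}\le\delta$, and let $\alpha=\alpha(\delta,f^\delta)>0$ and $$\varphi_{\alpha(\delta,f^\delta)}\in\arg\min_{\varphi\in W^{1,2}(\Omega)}\left\{\tfrac12\|\mathcal{T}\varphi-f^\delta\|_{L^2(\mathcal{Z})}^2+\alpha J_\beta^{\mathrm{TV}}(\varphi)\right\}$$ be chosen by the a posteriori rule $$\underline{\tau}\delta\le\|\mathcal{T}\varphi_{\alpha(\delta,f^\delta)}-f^\delta\|_{L^2(\mathcal{Z})}\le\overline{\tau}\delta .$$ Suppose that $\varphi=\varphi_{\alpha(\delta,f^\delta)}$ satisfies the variational inequality $$\tilde\gamma\|\varphi-\varphi^\dagger\|_{L^2(\Omega)}^2\le J_\beta^{\mathrm{TV}}(\varphi)-J_\beta^{\mathrm{TV}}(\varphi^\dagger)+\Psi\big(\|\mathcal{T}\varphi-\mathcal{T}\varphi^\dagger\|_{L^2(\mathcal{Z})}\big).$$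 Then $$\|\varphi_{\alpha(\delta,f^\delta)}-\varphi^\dagger\|_{L^2(\Omega)}^2=O(\Psi(\delta))\qquad\text{as }\delta\to0 .$$
   Context: $\mathcal{Z}\subset\mathbb{R}_+$ is a compact domain, and $\|\cdot\|_2$ is the Euclidean norm. An index function is a continuous, monotonically increasing function $\Psi:[0,\infty)\to[0,\infty)$ with $\Psi(0)=0$. $\varphi^\dagger$ is the true solution and $f^\delta$ the noisy data. *)

theory Defs
  imports "HOL-Analysis.Analysis" "HOL-Library.Landau_Symbols"
begin

definition compact_domain :: "'a::euclidean_space set \<Rightarrow> bool" where
  "compact_domain S \<longleftrightarrow>
     compact S \<and> (\<exists>U. open U \<and> connected U \<and> U \<noteq> {} \<and> S = closure U)"

text \<open>
  Elements of \<open>L\<^sup>2\<close> and \<open>W\<^sup>1\<^sup>,\<^sup>2\<close> are represented by total functions, of which only the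
  almost-everywhere class on the underlying set matters; accordingly all statements about
  equality below are statements about almost-everywhere equality.
\<close>

definition L2_space ::
    "'a measure \<Rightarrow> ('a \<Rightarrow> 'b::{real_normed_vector, second_countable_topology}) set" where
  "L2_space M = {f \<in> borel_measurable M. integrable M (\<lambda>x. (norm (f x))\<^sup>2)}"

definition L2_norm :: "'a measure \<Rightarrow> ('a \<Rightarrow> 'b::real_normed_vector) \<Rightarrow> real" where
  "L2_norm M f = sqrt (LINT x|M. (norm (f x))\<^sup>2)"

primrec k_times_cont_diff :: "nat \<Rightarrow> ('a::euclidean_space \<Rightarrow> real) \<Rightarrow> bool" where
  "k_times_cont_diff 0 f \<longleftrightarrow> continuous_on UNIV f"
| "k_times_cont_diff (Suc k) f \<longleftrightarrow>
     (\<forall>x. f differentiable (at x)) \<and>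
     (\<forall>b\<in>Basis. k_times_cont_diff k (\<lambda>x. frechet_derivative f (at x) b))"

definition test_function :: "'a::euclidean_space set \<Rightarrow> ('a \<Rightarrow> real) \<Rightarrow> bool" where
  "test_function U \<eta> \<longleftrightarrow>
     (\<forall>k. k_times_cont_diff k \<eta>) \<and>
     compact (closure {x. \<eta> x \<noteq> 0}) \<and> closure {x. \<eta> x \<noteq> 0} \<subseteq> U"

definition is_weak_gradient ::
    "'a::euclidean_space set \<Rightarrow> ('a \<Rightarrow> real) \<Rightarrow> ('a \<Rightarrow> 'a) \<Rightarrow> bool" where
  "is_weak_gradient \<Omega> f g \<longleftrightarrow>
     (\<forall>\<eta>. test_function (interior \<Omega>) \<eta> \<longrightarrow>
       (\<forall>b\<in>Basis. (LINT x|lebesgue_on \<Omega>. f x * frechet_derivative \<eta> (at x) b)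
                 = - (LINT x|lebesgue_on \<Omega>. (g x \<bullet> b) * \<eta> x)))"

definition W12 :: "'a::euclidean_space set \<Rightarrow> ('a \<Rightarrow> real) set" where
  "W12 \<Omega> = {f \<in> L2_space (lebesgue_on \<Omega>).
              \<exists>g \<in> L2_space (lebesgue_on \<Omega>). is_weak_gradient \<Omega> f g}"

text \<open>
  The weak gradient is unique up to null sets of the interior, so on a set with null
  boundary (e.g. a convex one) the choice made here is immaterial under the integral.
\<close>

definition weak_gradient ::
    "'a::euclidean_space set \<Rightarrow> ('a \<Rightarrow> real) \<Rightarrow> 'a \<Rightarrow> 'a" where
  "weak_gradient \<Omega> f = (SOME g. g \<in> L2_space (lebesgue_on \<Omega>) \<and> is_weak_gradient \<Omega> f g)"

definition W12_norm :: "'a::euclidean_space set \<Rightarrow> ('a \<Rightarrow> real) \<Rightarrow> real" where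
  "W12_norm \<Omega> f = sqrt ((L2_norm (lebesgue_on \<Omega>) f)\<^sup>2
                        + (L2_norm (lebesgue_on \<Omega>) (weak_gradient \<Omega> f))\<^sup>2)"

definition J_TV :: "real \<Rightarrow> 'a::euclidean_space set \<Rightarrow> ('a \<Rightarrow> real) \<Rightarrow> real" where
  "J_TV \<beta> \<Omega> \<phi> = (LINT x|lebesgue_on \<Omega>. sqrt ((norm (weak_gradient \<Omega> \<phi> x))\<^sup>2 + \<beta>))"

text \<open>
  An operator from \<open>W\<^sup>1\<^sup>,\<^sup>2(\<Omega>)\<close> to \<open>L\<^sup>2(Z)\<close> acts on representatives; the second clause says that it
  descends to almost-everywhere classes.
\<close>

definition linear_operator ::
    "'a::euclidean_space set \<Rightarrow> 'b::euclidean_space set \<Rightarrow>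
     (('a \<Rightarrow> real) \<Rightarrow> 'b \<Rightarrow> real) \<Rightarrow> bool" where
  "linear_operator \<Omega> Z T \<longleftrightarrow>
     (\<forall>\<phi>\<in>W12 \<Omega>. T \<phi> \<in> L2_space (lebesgue_on Z)) \<and>
     (\<forall>\<phi>\<in>W12 \<Omega>. \<forall>\<psi>\<in>W12 \<Omega>. (AE x in lebesgue_on \<Omega>. \<phi> x = \<psi> x) \<longrightarrow>
        (AE z in lebesgue_on Z. T \<phi> z = T \<psi> z)) \<and>
     (\<forall>\<phi>\<in>W12 \<Omega>. \<forall>\<psi>\<in>W12 \<Omega>.
        AE z in lebesgue_on Z. T (\<lambda>x. \<phi> x + \<psi> x) z = T \<phi> z + T \<psi> z) \<and>
     (\<forall>\<phi>\<in>W12 \<Omega>. \<forall>c. AE z in lebesgue_on Z. T (\<lambda>x. c * \<phi> x) z = c * T \<phi> z)"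

definition compact_operator ::
    "'a::euclidean_space set \<Rightarrow> 'b::euclidean_space set \<Rightarrow>
     (('a \<Rightarrow> real) \<Rightarrow> 'b \<Rightarrow> real) \<Rightarrow> bool" where
  "compact_operator \<Omega> Z T \<longleftrightarrow>
     (\<forall>s. range s \<subseteq> W12 \<Omega> \<and> (\<exists>C. \<forall>n::nat. W12_norm \<Omega> (s n) \<le> C) \<longrightarrow>
       (\<exists>r. strict_mono r \<and> (\<exists>g\<in>L2_space (lebesgue_on Z).
          (\<lambda>n. L2_norm (lebesgue_on Z) (\<lambda>z. T (s (r n)) z - g z)) \<longlonglongrightarrow> 0)))"

definition injective_operator ::
    "'a::euclidean_space set \<Rightarrow> 'b::euclidean_space set \<Rightarrow>
     (('a \<Rightarrow> real) \<Rightarrow> 'b \<Rightarrow> real) \<Rightarrow> bool" where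
  "injective_operator \<Omega> Z T \<longleftrightarrow>
     (\<forall>\<phi>\<in>W12 \<Omega>. \<forall>\<psi>\<in>W12 \<Omega>. (AE z in lebesgue_on Z. T \<phi> z = T \<psi> z) \<longrightarrow>
        (AE x in lebesgue_on \<Omega>. \<phi> x = \<psi> x))"

definition index_function :: "(real \<Rightarrow> real) \<Rightarrow> bool" where
  "index_function \<Psi> \<longleftrightarrow>
     (\<forall>t\<ge>0. \<Psi> t \<ge> 0) \<and> continuous_on {0..} \<Psi> \<and> mono_on {0..} \<Psi> \<and> \<Psi> 0 = 0"

end

theory Submission
  imports Defs
begin

text \<open>
  Comparing the minimiser \<open>\<phi>\<close> with \<open>\<phi>\<^sup>\<dagger>\<close> in the Tikhonov functional, the lower discrepancy
  bound \<open>\<tau>_lo \<ge> 1\<close> makes the data term of \<open>\<phi>\<close> at least that of \<open>\<phi>\<^sup>\<dagger>\<close>, so the penalty of \<open>\<phi>\<close> is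
  at most that of \<open>\<phi>\<^sup>\<dagger>\<close> and the variational inequality reduces to its \<open>\<Psi>\<close>-term. The upper
  discrepancy bound gives \<open>\<parallel>T \<phi> - T \<phi>\<^sup>\<dagger>\<parallel> \<le> c \<delta>\<close>, and a concave \<open>\<Psi>\<close> with \<open>\<Psi> 0 = 0\<close> satisfies
  \<open>\<Psi> (c \<delta>) \<le> c \<Psi> \<delta>\<close> for \<open>c \<ge> 1\<close>.
\<close>

text \<open>Triangle inequality plus \<open>(norm x - norm y)\<^sup>2 \<ge> 0\<close>. It serves
  twice: as an integrable majorant showing that \<open>L2_space\<close> is closed under differences,
  and, once integrated, as a norm estimate.\<close>

lemma norm_diff_power2_le:
  fixes x y :: "'a::real_normed_vector"
  shows "(norm (x - y))\<^sup>2 \<le> 2 * (norm x)\<^sup>2 + 2 * (norm y)\<^sup>2"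
proof -
  have "(norm (x - y))\<^sup>2 \<le> (norm x + norm y)\<^sup>2"
    by (intro power_mono norm_triangle_ineq4) simp
  also have "\<dots> \<le> 2 * (norm x)\<^sup>2 + 2 * (norm y)\<^sup>2"
    using zero_le_power2[of "norm x - norm y"] unfolding power2_sum power2_diff by linarith
  finally show ?thesis .
qed

lemma L2_space_diff:
  assumes "f \<in> L2_space M" "g \<in> L2_space M"
  shows "(\<lambda>x. f x - g x) \<in> L2_space M"
proof -
  have [measurable]: "f \<in> borel_measurable M" "g \<in> borel_measurable M"
    using assms by (auto simp: L2_space_def)
  have "integrable M (\<lambda>x. 2 * (norm (f x))\<^sup>2 + 2 * (norm (g x))\<^sup>2)"
    using assms by (auto simp: L2_space_def)
  then have "integrable M (\<lambda>x. (norm (f x - g x))\<^sup>2)"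
    by (rule Bochner_Integration.integrable_bound) (auto simp: norm_diff_power2_le)
  then show ?thesis
    by (simp add: L2_space_def)
qed

lemma L2_norm_power2: "(L2_norm M f)\<^sup>2 = (LINT x|M. (norm (f x))\<^sup>2)"
  by (simp add: L2_norm_def)

lemma L2_norm_nonneg: "L2_norm M f \<ge> 0"
  by (simp add: L2_norm_def)

text \<open>A squared stand-in for the triangle inequality, obtained by integrating the pointwise
  bound; it loses nothing when the two norms coincide.\<close>

lemma L2_norm_diff_power2_le:
  assumes "f \<in> L2_space M" "g \<in> L2_space M"
  shows "(L2_norm M (\<lambda>x. f x - g x))\<^sup>2 \<le> 2 * (L2_norm M f)\<^sup>2 + 2 * (L2_norm M g)\<^sup>2"
proof -
  have int: "integrable M (\<lambda>x. (norm (f x))\<^sup>2)" "integrable M (\<lambda>x. (norm (g x))\<^sup>2)"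
       "integrable M (\<lambda>x. (norm (f x - g x))\<^sup>2)"
    using assms L2_space_diff[OF assms] by (auto simp: L2_space_def)
  have "(LINT x|M. (norm (f x - g x))\<^sup>2) \<le> (LINT x|M. 2 * (norm (f x))\<^sup>2 + 2 * (norm (g x))\<^sup>2)"
    using int by (intro integral_mono) (auto simp: norm_diff_power2_le)
  also have "\<dots> = 2 * (LINT x|M. (norm (f x))\<^sup>2) + 2 * (LINT x|M. (norm (g x))\<^sup>2)"
    using int by simp
  finally show ?thesis
    by (simp add: L2_norm_power2)
qed

text \<open>The point \<open>t\<close> is the convex combination of \<open>0\<close> and
  \<open>c * t\<close> with weight \<open>1/c\<close> on the latter, and \<open>h 0 = 0\<close>
  removes the other term.\<close>

lemma concave_on_scale_le:
  fixes h :: "real \<Rightarrow> real"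
  assumes "concave_on {0..} h" "h 0 = 0" "c \<ge> 1" "t \<ge> 0"
  shows "h (c * t) \<le> c * h t"
proof -
  have "(1 - 1/c) * h 0 + (1/c) * h (c * t) \<le> h ((1 - 1/c) *\<^sub>R 0 + (1/c) *\<^sub>R (c * t))"
    using assms by (intro concave_onD) auto
  then show ?thesis
    using assms by (simp add: field_simps)
qed

theorem corollary4p4:
  fixes \<Omega> :: "(real^3) set" and Z :: "real set"
    and T :: "(real^3 \<Rightarrow> real) \<Rightarrow> real \<Rightarrow> real"
    and \<phi>_true :: "real^3 \<Rightarrow> real"
    and \<Psi> :: "real \<Rightarrow> real"
    and \<beta> \<gamma> \<tau>_lo \<tau>_hi :: real
    and D :: "real set"
    and f :: "real \<Rightarrow> real \<Rightarrow> real"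
    and \<alpha> :: "real \<Rightarrow> (real \<Rightarrow> real) \<Rightarrow> real"
    and \<phi> :: "real \<Rightarrow> real^3 \<Rightarrow> real"
  assumes "compact_domain \<Omega>" and "convex \<Omega>"
    and "compact_domain Z" and "Z \<subseteq> {0..}"
    and "\<beta> > 0"
    and "linear_operator \<Omega> Z T" and "compact_operator \<Omega> Z T" and "injective_operator \<Omega> Z T"
    and "\<phi>_true \<in> W12 \<Omega>"
    and "index_function \<Psi>" and "concave_on {0..} \<Psi>"
    and "0 < \<gamma>" and "\<gamma> \<le> 1"
    and "1 \<le> \<tau>_lo" and "\<tau>_lo \<le> \<tau>_hi"
    and noise_levels: "D \<subseteq> {0<..}"
    and data: "\<And>\<delta>. \<delta> \<in> D \<Longrightarrow> f \<delta> \<in> L2_space (lebesgue_on Z)"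
    and noise: "\<And>\<delta>. \<delta> \<in> D \<Longrightarrow>
        L2_norm (lebesgue_on Z) (\<lambda>z. T \<phi>_true z - f \<delta> z) \<le> \<delta>"
    and "\<And>\<delta>. \<delta> \<in> D \<Longrightarrow> \<alpha> \<delta> (f \<delta>) > 0"
    and minimizer: "\<And>\<delta>. \<delta> \<in> D \<Longrightarrow>
        is_arg_min
          (\<lambda>\<psi>. 1/2 * (L2_norm (lebesgue_on Z) (\<lambda>z. T \<psi> z - f \<delta> z))\<^sup>2
                + \<alpha> \<delta> (f \<delta>) * J_TV \<beta> \<Omega> \<psi>)
          (\<lambda>\<psi>. \<psi> \<in> W12 \<Omega>) (\<phi> \<delta>)"
    and discrepancy: "\<And>\<delta>. \<delta> \<in> D \<Longrightarrow>
        \<tau>_lo * \<delta> \<le> L2_norm (lebesgue_on Z) (\<lambda>z. T (\<phi> \<delta>) z - f \<delta> z) \<and>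
        L2_norm (lebesgue_on Z) (\<lambda>z. T (\<phi> \<delta>) z - f \<delta> z) \<le> \<tau>_hi * \<delta>"
    and variational_ineq: "\<And>\<delta>. \<delta> \<in> D \<Longrightarrow>
        \<gamma> * (L2_norm (lebesgue_on \<Omega>) (\<lambda>x. \<phi> \<delta> x - \<phi>_true x))\<^sup>2
          \<le> J_TV \<beta> \<Omega> (\<phi> \<delta>) - J_TV \<beta> \<Omega> \<phi>_true
             + \<Psi> (L2_norm (lebesgue_on Z) (\<lambda>z. T (\<phi> \<delta>) z - T \<phi>_true z))"
  shows "(\<lambda>\<delta>. (L2_norm (lebesgue_on \<Omega>) (\<lambda>x. \<phi> \<delta> x - \<phi>_true x))\<^sup>2)
           \<in> O[at 0 within D](\<Psi>)"
proof (rule bigoI)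
  \<comment> \<open>The factor 2 comes from \<open>t \<le> 2 * r\<close> below, and
    \<open>\<tau>_hi\<close> from \<open>r \<le> \<tau>_hi * \<delta>\<close>.\<close>
  define c where "c = 2 * \<tau>_hi"
  have "c \<ge> 1"
    using assms(14,15) by (simp add: c_def)
  have "(L2_norm (lebesgue_on \<Omega>) (\<lambda>x. \<phi> \<delta> x - \<phi>_true x))\<^sup>2 \<le> c / \<gamma> * \<Psi> \<delta>" if "\<delta> \<in> D" for \<delta>
  proof -
    let ?N = "L2_norm (lebesgue_on Z)"
    define r where "r = ?N (\<lambda>z. T (\<phi> \<delta>) z - f \<delta> z)"
    define s where "s = ?N (\<lambda>z. T \<phi>_true z - f \<delta> z)"
    define t where "t = ?N (\<lambda>z. T (\<phi> \<delta>) z - T \<phi>_true z)"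
    have "\<delta> > 0"
      using noise_levels that by auto
    have "\<delta> \<le> \<tau>_lo * \<delta>"
      using \<open>\<delta> > 0\<close> assms(14) by simp
    then have "\<delta> \<le> r" "r \<le> \<tau>_hi * \<delta>" "0 \<le> s" "s \<le> \<delta>"
      using discrepancy[OF that] noise[OF that] by (auto simp: r_def s_def L2_norm_nonneg)
    \<comment> \<open>Minimality is tested against the competitor
      \<open>\<phi>_true\<close>.\<close>
    have min: "\<phi> \<delta> \<in> W12 \<Omega>"
         "1/2 * r\<^sup>2 + \<alpha> \<delta> (f \<delta>) * J_TV \<beta> \<Omega> (\<phi> \<delta>) \<le> 1/2 * s\<^sup>2 + \<alpha> \<delta> (f \<delta>) * J_TV \<beta> \<Omega> \<phi>_true"
      using minimizer[OF that] \<open>\<phi>_true \<in> W12 \<Omega>\<close>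
      unfolding is_arg_min_def r_def s_def by (auto simp: not_less)
    have "s\<^sup>2 \<le> r\<^sup>2"
      using \<open>0 \<le> s\<close> \<open>s \<le> \<delta>\<close> \<open>\<delta> \<le> r\<close> by (intro power_mono) auto
    then have "\<alpha> \<delta> (f \<delta>) * J_TV \<beta> \<Omega> (\<phi> \<delta>) \<le> \<alpha> \<delta> (f \<delta>) * J_TV \<beta> \<Omega> \<phi>_true"
      using min(2) by linarith
    then have J_le: "J_TV \<beta> \<Omega> (\<phi> \<delta>) \<le> J_TV \<beta> \<Omega> \<phi>_true"
      using assms(19)[OF that] by simp
    have "T (\<phi> \<delta>) \<in> L2_space (lebesgue_on Z)" "T \<phi>_true \<in> L2_space (lebesgue_on Z)"
      using \<open>linear_operator \<Omega> Z T\<close> min(1) \<open>\<phi>_true \<in> W12 \<Omega>\<close> by (auto simp: linear_operator_def)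
    \<comment> \<open>The data \<open>f \<delta>\<close> cancel pointwise in the difference of the
      two residuals.\<close>
    then have "t\<^sup>2 \<le> 2 * r\<^sup>2 + 2 * s\<^sup>2"
      using L2_norm_diff_power2_le[of "\<lambda>z. T (\<phi> \<delta>) z - f \<delta> z" "lebesgue_on Z"
          "\<lambda>z. T \<phi>_true z - f \<delta> z"]
      by (simp add: L2_space_diff data[OF that] r_def s_def t_def)
    \<comment> \<open>Replacing \<open>s\<close> by the larger \<open>r\<close> leaves a perfect
      square, so roots can be taken.\<close>
    also have "\<dots> \<le> 4 * r\<^sup>2"
      using \<open>s\<^sup>2 \<le> r\<^sup>2\<close> by simp
    also have "\<dots> = (2 * r)\<^sup>2"
      by (simp add: power_mult_distrib)
    finally have "t \<le> 2 * r"
      by (rule power2_le_imp_le) (use \<open>\<delta> > 0\<close> \<open>\<delta> \<le> r\<close> in simp)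
    then have "t \<le> c * \<delta>"
      using \<open>r \<le> \<tau>_hi * \<delta>\<close> by (simp add: c_def)
    moreover have "t \<ge> 0"
      by (simp add: t_def L2_norm_nonneg)
    ultimately have "\<Psi> t \<le> \<Psi> (c * \<delta>)"
      using \<open>index_function \<Psi>\<close> by (auto simp: index_function_def mono_on_def)
    also have "\<dots> \<le> c * \<Psi> \<delta>"
      using \<open>index_function \<Psi>\<close> \<open>concave_on {0..} \<Psi>\<close> \<open>c \<ge> 1\<close> \<open>\<delta> > 0\<close>
      by (intro concave_on_scale_le) (auto simp: index_function_def)
    finally have "\<Psi> t \<le> c * \<Psi> \<delta>" .
    with variational_ineq[OF that] J_le
    have "\<gamma> * (L2_norm (lebesgue_on \<Omega>) (\<lambda>x. \<phi> \<delta> x - \<phi>_true x))\<^sup>2 \<le> c * \<Psi> \<delta>"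
      unfolding t_def by linarith
    then show ?thesis
      using \<open>0 < \<gamma>\<close> by (simp add: field_simps)
  qed
  \<comment> \<open>The O-notation compares absolute values; \<open>\<Psi>\<close> is known to be
    nonnegative only on \<open>{0..}\<close>, which contains \<open>D\<close>.\<close>
  moreover have "\<Psi> \<delta> = norm (\<Psi> \<delta>)" if "\<delta> \<in> D" for \<delta>
    using that noise_levels \<open>index_function \<Psi>\<close> by (auto simp: index_function_def)
  \<comment> \<open>The estimate holds for every \<open>\<delta>\<close> in \<open>D\<close> with
    the same constant \<open>c / \<gamma>\<close>, hence eventually in the filter restricted to
    \<open>D\<close>.\<close>
  ultimately show "\<forall>\<^sub>F \<delta> in at 0 within D.
      norm ((L2_norm (lebesgue_on \<Omega>) (\<lambda>x. \<phi> \<delta> x - \<phi>_true x))\<^sup>2) \<le> c / \<gamma> * norm (\<Psi> \<delta>)"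
    by (auto simp: eventually_at_filter intro!: always_eventually)
qed

end
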